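(* Let $0\leqslant\alpha<\beta\leqslant1$. If a sequence $(x_n)_{n\in\mathbb N}\subseteq[0,1]$ has $\beta$--PPC, then it also has $\alpha$--PPC.
   Context: For $x\in\mathbb R$, $\|x\|$ is the distance from $x$ to the nearest integer. For $0\leqslant\gamma\leqslant1$, $s>0$, $N\geqslant1$: $R_2(\gamma;s,N)=\frac{1}{N^{2-\gamma}}\#\{(m,n):1\leqslant m,n\leqslant N,\ m\neq n,\ \|x_m-x_n\|\leqslant s/N^{\gamma}\}$. For $0<\gamma\leqslant1$, the sequence has $\gamma$--PPC if $\lim_{N\to\infty}R_2(\gamma;s,N)=2s$ for all $s>0$ (for $\gamma=1$ this is classical Poissonian pair correlations); it has $0$--PPC if $\lim_{N\to\infty}R_2(0;s,N)=2s$ for all $0<s\leqslant\frac12$. *)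

theory Defs
  imports "HOL-Analysis.Analysis"
begin

(* \<open>round x\<close> is an integer nearest to x, cf. round_diff_minimal. *)
definition dist_nearest_int :: "real \<Rightarrow> real" where
  "dist_nearest_int x = \<bar>x - of_int (round x)\<bar>"

(* Sequences are indexed by n \<ge> 1; the value of x at 0 is never used. *)
definition pair_corr :: "(nat \<Rightarrow> real) \<Rightarrow> real \<Rightarrow> real \<Rightarrow> nat \<Rightarrow> real" where
  "pair_corr x \<gamma> s N =
     1 / real N powr (2 - \<gamma>) *
     real (card {(m, n). m \<in> {1..N} \<and> n \<in> {1..N} \<and> m \<noteq> n \<and>
                   dist_nearest_int (x m - x n) \<le> s / real N powr \<gamma>})"

definition has_PPC :: "real \<Rightarrow> (nat \<Rightarrow> real) \<Rightarrow> bool" where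
  "has_PPC \<gamma> x \<longleftrightarrow>
     (if \<gamma> = 0 then \<forall>s. 0 < s \<and> s \<le> 1 / 2 \<longrightarrow> pair_corr x 0 s \<longlonglongrightarrow> 2 * s
      else \<forall>s>0. pair_corr x \<gamma> s \<longlonglongrightarrow> 2 * s)"

end

theory Submission
  imports Defs
begin

text \<open>
  Cut the circle into \<open>K = \<lceil>N\<^sup>\<beta>\<rceil>\<close> cells and let \<open>G k\<close> be the number of points among
  \<open>x 1, \<dots>, x N\<close> lying in the \<open>D\<close> consecutive cells starting at \<open>k\<close>. The sum of \<open>G k ^ 2\<close> over
  \<open>k\<close> is a sum over pairs weighted by a tent function of width \<open>D / K\<close>, so \<open>\<beta>\<close>-PPC at the \<open>D\<close>
  values \<open>s = 1, \<dots>, D\<close> bounds it by \<open>1 + O(1 / D)\<close> times its minimum \<open>(N D)\<^sup>2 / K\<close>, which is attained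
  when \<open>G\<close> is constant. Hence \<open>G\<close> has small variance, and all correlations
  \<open>\<Sum>k. G k * G (k + h)\<close> are within \<open>O(1 / D)\<close> of \<open>(N D)\<^sup>2 / K\<close>, relatively.
  At the coarser scale \<open>s / N\<^sup>\<alpha>\<close>, the number of close pairs is up to boundary effects of order \<open>D\<close> cells
  the sum of these correlations over \<open>\<bar>h\<bar> \<le> s K / N\<^sup>\<alpha>\<close>, divided by \<open>D\<^sup>2\<close>. Let first \<open>N\<close> and
  then \<open>D\<close> tend to infinity.
\<close>

section \<open>Cyclic autocorrelation of a counting function modulo \<open>K\<close>\<close>

text \<open>For \<open>K > 0\<close> this is the autocorrelation
  \<open>\<Sum>k. g k * g (k + h)\<close> over residues \<open>k\<close>, where \<open>g k\<close>
  counts the \<open>p\<close> in \<open>J\<close> with \<open>b p\<close> congruent to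
  \<open>k\<close>. The form as a sum over pairs is the one that can be compared with pair
  counts.\<close>

definition residue_corr :: "int \<Rightarrow> ('a \<Rightarrow> int) \<Rightarrow> 'a set \<Rightarrow> int \<Rightarrow> real" where
  "residue_corr K b J h = (\<Sum>p\<in>J. \<Sum>q\<in>J. of_bool (K dvd b q - b p - h))"

lemma unique_residue:
  fixes K c :: int
  assumes "K > 0"
  shows "k \<in> {0..<K} \<and> K dvd c - k \<longleftrightarrow> k = c mod K"
  using assms by (metis atLeastLessThan_iff mod_eq_dvd_iff mod_pos_pos_trivial
      pos_mod_bound pos_mod_sign mod_mod_trivial)

lemma sum_residue_indicator:
  fixes K c :: int
  assumes "K > 0"
  shows "(\<Sum>k\<in>{0..<K}. of_bool (K dvd c - k) * f k :: real) = f (c mod K)"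
proof -
  have "(\<Sum>k\<in>{0..<K}. of_bool (K dvd c - k) * f k)
      = (\<Sum>k\<in>{0..<K}. if k = c mod K then f k else 0)"
    using unique_residue[OF assms, of _ c] by (intro sum.cong) auto
  also have "\<dots> = f (c mod K)"
    using assms by (simp add: sum.delta)
  finally show ?thesis .
qed

text \<open>After subtracting the mean \<open>\<mu>\<close>, the left side is the absolute
  covariance of the counting function and its shift by \<open>h\<close>, the right side its
  variance. A shift preserves the variance, so
  \<open>\<bar>a * b\<bar> \<le> (a * a + b * b) / 2\<close> suffices.\<close>

lemma residue_corr_deviation:
  fixes b :: "'a \<Rightarrow> int"
  assumes "K > 0"
  shows "\<bar>residue_corr K b J h - (real (card J))\<^sup>2 / of_int K\<bar>
           \<le> residue_corr K b J 0 - (real (card J))\<^sup>2 / of_int K"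
proof -
  define g where "g u k = (\<Sum>p\<in>J. of_bool (K dvd (b p - u) - k) :: real)" for u k
  define \<mu> where "\<mu> = real (card J) / of_int K"
  let ?Z = "{0..<K}"
  have g_sum: "(\<Sum>k\<in>?Z. g u k) = card J" for u
  proof -
    have "(\<Sum>k\<in>?Z. g u k) = (\<Sum>p\<in>J. \<Sum>k\<in>?Z. of_bool (K dvd (b p - u) - k) * 1)"
      unfolding g_def by (subst sum.swap) simp
    then show ?thesis by (simp only: sum_residue_indicator[OF assms]) simp
  qed
  have g_prod: "(\<Sum>k\<in>?Z. g u k * g v k)
      = (\<Sum>p\<in>J. \<Sum>q\<in>J. of_bool (K dvd b q - b p - (v - u)))" for u v
  proof -
    have "(\<Sum>k\<in>?Z. g u k * g v k)
      = (\<Sum>k\<in>?Z. \<Sum>p\<in>J. \<Sum>q\<in>J. of_bool (K dvd (b p - u) - k) * of_bool (K dvd (b q - v) - k))"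
      unfolding g_def by (simp only: sum_product)
    also have "\<dots> = (\<Sum>p\<in>J. \<Sum>q\<in>J. \<Sum>k\<in>?Z. of_bool (K dvd (b p - u) - k) * of_bool (K dvd (b q - v) - k))"
      by (subst sum.swap, rule sum.cong[OF refl], rule sum.swap)
    also have "\<dots> = (\<Sum>p\<in>J. \<Sum>q\<in>J. of_bool (K dvd (b q - v) - (b p - u) mod K))"
      by (simp only: sum_residue_indicator[OF assms])
    also have "\<dots> = (\<Sum>p\<in>J. \<Sum>q\<in>J. of_bool (K dvd b q - b p - (v - u)))"
    proof -
      have "K dvd (b q - v) - (b p - u) mod K \<longleftrightarrow> K dvd (b q - v) - (b p - u)" for p q
        by (simp add: mod_eq_dvd_iff[symmetric])
      moreover have "(b q - v) - (b p - u) = b q - b p - (v - u)" for p q by simp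
      ultimately show ?thesis by (simp only:)
    qed
    finally show ?thesis .
  qed
  have dev: "(\<Sum>k\<in>?Z. (g u k - \<mu>) * (g v k - \<mu>))
      = residue_corr K b J (v - u) - (real (card J))\<^sup>2 / of_int K" for u v
  proof -
    have "(\<Sum>k\<in>?Z. (g u k - \<mu>) * (g v k - \<mu>))
      = (\<Sum>k\<in>?Z. g u k * g v k) - \<mu> * (\<Sum>k\<in>?Z. g u k) - \<mu> * (\<Sum>k\<in>?Z. g v k)
        + of_int K * \<mu>\<^sup>2"
      using assms by (simp add: algebra_simps sum.distrib sum_subtractf sum_distrib_left power2_eq_square)
    also have "\<dots> = residue_corr K b J (v - u) - \<mu> * card J - \<mu> * card J + of_int K * \<mu>\<^sup>2"
      unfolding g_sum g_prod residue_corr_def by simp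
    also have "\<dots> = residue_corr K b J (v - u) - (real (card J))\<^sup>2 / of_int K"
      using assms unfolding \<mu>_def by (simp add: power2_eq_square)
    finally show ?thesis .
  qed
  have "\<bar>\<Sum>k\<in>?Z. (g 0 k - \<mu>) * (g h k - \<mu>)\<bar>
      \<le> (\<Sum>k\<in>?Z. \<bar>(g 0 k - \<mu>) * (g h k - \<mu>)\<bar>)"
    by (rule sum_abs)
  also have "\<dots> \<le> (\<Sum>k\<in>?Z. ((g 0 k - \<mu>) * (g 0 k - \<mu>) + (g h k - \<mu>) * (g h k - \<mu>)) / 2)"
  proof (rule sum_mono)
    fix k
    have "\<bar>a * b\<bar> \<le> (a * a + b * b) / 2" for a b :: real
      using sum_squares_bound[of "\<bar>a\<bar>" "\<bar>b\<bar>"] by (simp add: abs_mult power2_eq_square)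
    then show "\<bar>(g 0 k - \<mu>) * (g h k - \<mu>)\<bar>
      \<le> ((g 0 k - \<mu>) * (g 0 k - \<mu>) + (g h k - \<mu>) * (g h k - \<mu>)) / 2" .
  qed
  \<comment> \<open>Both squares fall under \<open>dev\<close> with \<open>v = u\<close>, where only
    \<open>v - u = 0\<close> matters.\<close>
  also have "\<dots> = residue_corr K b J 0 - (real (card J))\<^sup>2 / of_int K"
    unfolding sum_divide_distrib[symmetric] sum.distrib dev by simp
  finally show ?thesis
    unfolding dev by simp
qed

section \<open>Distances on the circle and offsets between grid cells\<close>

text \<open>Unlike in \<^const>\<open>pair_corr\<close>, the diagonal is included.\<close>
definition close_pairs :: "(nat \<Rightarrow> real) \<Rightarrow> nat \<Rightarrow> real \<Rightarrow> real" where
  "close_pairs x N r = (\<Sum>m\<in>{1..N}. \<Sum>n\<in>{1..N}. of_bool (dist_nearest_int (x m - x n) \<le> r))"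

lemma dist_nearest_int_le: "dist_nearest_int y \<le> \<bar>y - of_int z\<bar>"
  unfolding dist_nearest_int_def by (rule round_diff_minimal)

text \<open>Replacing \<open>K * y\<close> and \<open>K * z\<close> by their floors changes the
  difference by less than 1, which is the summand 1 in the numerator. Multiples of \<open>K\<close>
  are whole turns around the circle.\<close>

lemma dist_nearest_int_grid:
  fixes K e :: int and y z :: real
  assumes "K > 0" and "K dvd \<lfloor>of_int K * z\<rfloor> - \<lfloor>of_int K * y\<rfloor> - e"
  shows "dist_nearest_int (y - z) \<le> (\<bar>of_int e\<bar> + 1) / of_int K"
proof -
  obtain t where t: "\<lfloor>of_int K * z\<rfloor> - \<lfloor>of_int K * y\<rfloor> - e = K * t"
    using assms(2) by (elim dvdE)
  have "of_int \<lfloor>of_int K * z\<rfloor> - of_int \<lfloor>of_int K * y\<rfloor> - of_int e = (of_int K * of_int t :: real)"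
    using arg_cong[OF t, of real_of_int] by simp
  moreover have "of_int \<lfloor>of_int K * z\<rfloor> \<le> of_int K * z" "of_int K * z < of_int \<lfloor>of_int K * z\<rfloor> + 1"
    "of_int \<lfloor>of_int K * y\<rfloor> \<le> of_int K * y" "of_int K * y < of_int \<lfloor>of_int K * y\<rfloor> + 1"
    by linarith+
  ultimately have "\<bar>of_int K * y - of_int K * z + of_int K * of_int t\<bar> \<le> \<bar>real_of_int e\<bar> + 1"
    by linarith
  moreover have "of_int K * y - of_int K * z + of_int K * of_int t = of_int K * ((y - z) - of_int (- t))"
    by (simp add: algebra_simps)
  ultimately have "of_int K * \<bar>(y - z) - of_int (- t)\<bar> \<le> \<bar>real_of_int e\<bar> + 1"
    using assms(1) by (simp add: abs_mult)
  then have "\<bar>(y - z) - of_int (- t)\<bar> \<le> (\<bar>of_int e\<bar> + 1) / of_int K"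
    using assms(1) by (simp add: pos_le_divide_eq mult.commute)
  then show ?thesis
    using dist_nearest_int_le order_trans by blast
qed

text \<open>The converse of \<open>dist_nearest_int_grid\<close>, again losing one cell to the
  floors. The witness is the cell difference corrected by \<open>K\<close> times the integer nearest
  to \<open>y - z\<close>.\<close>

lemma grid_offset_of_close:
  fixes K :: int and y z :: real
  assumes "K > 0" and "dist_nearest_int (y - z) \<le> r"
  obtains e :: int where "K dvd \<lfloor>of_int K * z\<rfloor> - \<lfloor>of_int K * y\<rfloor> - e"
    and "\<bar>of_int e\<bar> \<le> r * of_int K + 1"
proof -
  define t where "t = round (y - z)"
  define e where "e = \<lfloor>of_int K * z\<rfloor> - \<lfloor>of_int K * y\<rfloor> + K * t"
  have "\<bar>y - z - of_int t\<bar> \<le> r"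
    using assms(2) unfolding dist_nearest_int_def t_def .
  then have "of_int K * \<bar>y - z - of_int t\<bar> \<le> of_int K * r"
    using assms(1) by (intro mult_left_mono) auto
  then have "\<bar>of_int K * y - of_int K * z - of_int K * of_int t\<bar> \<le> r * of_int K"
    using assms(1) by (simp add: abs_mult_pos' algebra_simps)
  moreover have "of_int e = (of_int \<lfloor>of_int K * z\<rfloor> - of_int \<lfloor>of_int K * y\<rfloor> + of_int K * of_int t :: real)"
    by (simp add: e_def)
  moreover have "of_int \<lfloor>of_int K * z\<rfloor> \<le> of_int K * z" "of_int K * z < of_int \<lfloor>of_int K * z\<rfloor> + 1"
    "of_int \<lfloor>of_int K * y\<rfloor> \<le> of_int K * y" "of_int K * y < of_int \<lfloor>of_int K * y\<rfloor> + 1"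
    by linarith+
  ultimately have "\<bar>real_of_int e\<bar> \<le> r * of_int K + 1"
    by linarith
  moreover have "K dvd \<lfloor>of_int K * z\<rfloor> - \<lfloor>of_int K * y\<rfloor> - e"
    by (simp add: e_def)
  ultimately show ?thesis
    using that by blast
qed

section \<open>Window correlations and their comparison with close pairs\<close>

text \<open>
  An index \<open>(n, i)\<close> stands for the window starting \<open>i\<close> cells before the cell of \<open>x n\<close>, so
  \<open>window_corr x N K D h\<close> is \<open>\<Sum>k. G k * G (k + h)\<close> with \<open>k\<close> ranging over residues modulo \<open>K\<close>.
\<close>
definition window_corr :: "(nat \<Rightarrow> real) \<Rightarrow> nat \<Rightarrow> int \<Rightarrow> nat \<Rightarrow> int \<Rightarrow> real" where
  "window_corr x N K D h =
     residue_corr K (\<lambda>(n, i). \<lfloor>of_int K * x n\<rfloor> - i) ({1..N} \<times> {0..<int D}) h"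

lemma window_corr_deviation:
  assumes "K > 0"
  shows "\<bar>window_corr x N K D h - (real N * real D)\<^sup>2 / of_int K\<bar>
           \<le> window_corr x N K D 0 - (real N * real D)\<^sup>2 / of_int K"
  using residue_corr_deviation[OF assms, of "\<lambda>(n, i). \<lfloor>of_int K * x n\<rfloor> - i"
      "{1..N} \<times> {0..<int D}" h]
  by (simp add: window_corr_def)

lemma window_corr_eq:
  "window_corr x N K D h = (\<Sum>m\<in>{1..N}. \<Sum>n\<in>{1..N}. \<Sum>i\<in>{0..<int D}. \<Sum>j\<in>{0..<int D}.
     of_bool (K dvd \<lfloor>of_int K * x n\<rfloor> - \<lfloor>of_int K * x m\<rfloor> - (h + j - i)))"
proof -
  have "window_corr x N K D h = (\<Sum>m\<in>{1..N}. \<Sum>i\<in>{0..<int D}. \<Sum>n\<in>{1..N}. \<Sum>j\<in>{0..<int D}.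
     of_bool (K dvd \<lfloor>of_int K * x n\<rfloor> - \<lfloor>of_int K * x m\<rfloor> - (h + j - i)))"
    unfolding window_corr_def residue_corr_def sum.cartesian_product'[symmetric]
    by (simp add: algebra_simps sum.cartesian_product')
  also have "\<dots> = (\<Sum>m\<in>{1..N}. \<Sum>n\<in>{1..N}. \<Sum>i\<in>{0..<int D}. \<Sum>j\<in>{0..<int D}.
     of_bool (K dvd \<lfloor>of_int K * x n\<rfloor> - \<lfloor>of_int K * x m\<rfloor> - (h + j - i)))"
    by (rule sum.cong[OF refl], rule sum.swap)
  finally show ?thesis .
qed

lemma sum_of_bool_le_one:
  assumes "\<And>x y. x \<in> A \<Longrightarrow> y \<in> A \<Longrightarrow> P x \<Longrightarrow> P y \<Longrightarrow> x = y"
  shows "(\<Sum>x\<in>A. of_bool (P x) :: real) \<le> 1"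
proof (cases "finite A")
  case True
  then have "(\<Sum>x\<in>A. of_bool (P x) :: real) = real (card (A \<inter> {x. P x}))"
    by (simp add: sum_of_bool_eq)
  also have "card (A \<inter> {x. P x}) \<le> 1"
    using assms by (auto simp: card_le_Suc0_iff_eq True)
  finally show ?thesis by simp
qed simp

lemma eq_of_dvd_diff_small:
  fixes K u v c :: int
  assumes "K dvd c - u" "K dvd c - v" "\<bar>u - v\<bar> < K"
  shows "u = v"
proof -
  have "K dvd u - v"
    using dvd_diff[OF assms(2,1)] by simp
  then show ?thesis
    using assms(3) zdvd_not_zless[of "\<bar>u - v\<bar>" K] by auto
qed

text \<open>Two points at cell offset \<open>e\<close> share at most
  \<open>D - \<bar>e\<bar>\<close> windows if \<open>\<bar>e\<bar> < D\<close>. This is the number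
  of \<open>d < D\<close> with \<open>\<bar>e\<bar> \<le> d\<close>, and for each of these the
  points have distance at most \<open>(d + 1) / K\<close>. So the tent function is bounded by a sum
  of \<open>D\<close> indicators.\<close>

lemma window_corr_0_le:
  assumes "K > 0" and "2 * int D \<le> K"
  shows "window_corr x N K D 0 \<le> (\<Sum>d<D. close_pairs x N ((real d + 1) / of_int K))"
proof -
  have pair: "(\<Sum>i\<in>{0..<int D}. \<Sum>j\<in>{0..<int D}.
      of_bool (K dvd \<lfloor>of_int K * z\<rfloor> - \<lfloor>of_int K * y\<rfloor> - (0 + j - i)))
    \<le> (\<Sum>d<D. of_bool (dist_nearest_int (y - z) \<le> (real d + 1) / of_int K) :: real)" for y z
  proof -
    define c where "c = \<lfloor>of_int K * z\<rfloor> - \<lfloor>of_int K * y\<rfloor>"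
    let ?W = "{0..<int D} \<times> {0..<int D}"
    let ?S = "?W \<inter> {(i, j). K dvd c - (j - i)}"
    let ?T = "{..<D} \<inter> {d. dist_nearest_int (y - z) \<le> (real d + 1) / of_int K}"
    have "(\<Sum>i\<in>{0..<int D}. \<Sum>j\<in>{0..<int D}. of_bool (K dvd c - (0 + j - i)))
        = (\<Sum>p\<in>?W. of_bool (case p of (i, j) \<Rightarrow> K dvd c - (j - i)) :: real)"
      unfolding sum.cartesian_product by (intro sum.cong) auto
    also have "\<dots> = real (card ?S)"
      by (simp add: sum_of_bool_eq)
    also have "card ?S \<le> card ?T"
    proof (rule card_inj_on_le)
      \<comment> \<open>As \<open>2 * D \<le> K\<close>, the difference \<open>j - i\<close> is the same for all \<open>(i, j)\<close> in \<open>?S\<close>.\<close>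
      show "inj_on (\<lambda>(i, j). nat (max i j)) ?S"
      proof (rule inj_onI, clarsimp)
        fix i j i' j'
        assume *: "0 \<le> i" "i < int D" "0 \<le> j" "j < int D" "0 \<le> i'" "i' < int D"
          "0 \<le> j'" "j' < int D" "K dvd c - (j - i)" "K dvd c - (j' - i')"
          "nat (max i j) = nat (max i' j')"
        have "j - i = j' - i'"
          by (rule eq_of_dvd_diff_small[OF *(9,10)]) (use * assms in linarith)
        moreover have "max i j = max i' j'"
          using * by linarith
        ultimately show "i = i' \<and> j = j'"
          by linarith
      qed
      \<comment> \<open>Since \<open>i\<close> and \<open>j\<close> are nonnegative,
        \<open>\<bar>j - i\<bar> \<le> max i j\<close>.\<close>
      show "(\<lambda>(i, j). nat (max i j)) ` ?S \<subseteq> ?T"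
      proof (rule image_subsetI)
        fix p assume "p \<in> ?S"
        then obtain i j where p: "p = (i, j)" and
          *: "0 \<le> i" "i < int D" "0 \<le> j" "j < int D" "K dvd c - (j - i)"
          by auto
        have "dist_nearest_int (y - z) \<le> (\<bar>of_int (j - i)\<bar> + 1) / of_int K"
          using dist_nearest_int_grid[OF assms(1), of z y "j - i"] *(5) unfolding c_def by blast
        also have "\<dots> \<le> (real (nat (max i j)) + 1) / of_int K"
          using * assms(1) by (intro divide_right_mono) auto
        finally show "(case p of (i, j) \<Rightarrow> nat (max i j)) \<in> ?T"
          using * p by auto
      qed
    qed simp
    also have "real (card ?T) = (\<Sum>d<D. of_bool (dist_nearest_int (y - z) \<le> (real d + 1) / of_int K))"
      by (simp add: sum_of_bool_eq)
    finally show ?thesis unfolding c_def by simp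
  qed
  have "window_corr x N K D 0 \<le> (\<Sum>m\<in>{1..N}. \<Sum>n\<in>{1..N}. \<Sum>d<D.
      of_bool (dist_nearest_int (x m - x n) \<le> (real d + 1) / of_int K))"
    unfolding window_corr_eq by (intro sum_mono pair)
  also have "\<dots> = (\<Sum>m\<in>{1..N}. \<Sum>d<D. \<Sum>n\<in>{1..N}.
      of_bool (dist_nearest_int (x m - x n) \<le> (real d + 1) / of_int K))"
    by (rule sum.cong[OF refl], rule sum.swap)
  also have "\<dots> = (\<Sum>d<D. close_pairs x N ((real d + 1) / of_int K))"
    unfolding close_pairs_def by (rule sum.swap)
  finally show ?thesis .
qed

lemma sum_window_corr:
  "(\<Sum>h\<in>H. window_corr x N K D h)
     = (\<Sum>m\<in>{1..N}. \<Sum>n\<in>{1..N}. \<Sum>i\<in>{0..<int D}. \<Sum>j\<in>{0..<int D}. \<Sum>h\<in>H.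
          of_bool (K dvd \<lfloor>of_int K * x n\<rfloor> - \<lfloor>of_int K * x m\<rfloor> - (h + j - i)))"
  unfolding window_corr_eq
  by (subst sum.swap, rule sum.cong[OF refl], subst sum.swap, rule sum.cong[OF refl],
      subst sum.swap, rule sum.cong[OF refl], subst sum.swap, rule refl)

text \<open>A close pair at cell offset \<open>e\<close> is counted once for each of the
  \<open>D * D\<close> choices of \<open>(i, j)\<close>, namely by the shift
  \<open>h = e - j + i\<close>; \<open>R\<close> is large enough to admit all these shifts.\<close>

lemma close_pairs_le_window_corr:
  assumes "K > 0" and "r * of_int K + real D \<le> of_int R"
  shows "(real D)\<^sup>2 * close_pairs x N r \<le> (\<Sum>h\<in>{-R..R}. window_corr x N K D h)"
proof -
  have pair: "(real D)\<^sup>2 * of_bool (dist_nearest_int (y - z) \<le> r)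
    \<le> (\<Sum>i\<in>{0..<int D}. \<Sum>j\<in>{0..<int D}. \<Sum>h\<in>{-R..R}.
        of_bool (K dvd \<lfloor>of_int K * z\<rfloor> - \<lfloor>of_int K * y\<rfloor> - (h + j - i)))" (is "_ \<le> ?S") for y z
  proof (cases "dist_nearest_int (y - z) \<le> r")
    case True
    obtain e :: int where e: "K dvd \<lfloor>of_int K * z\<rfloor> - \<lfloor>of_int K * y\<rfloor> - e"
      "\<bar>of_int e\<bar> \<le> r * of_int K + 1"
      using grid_offset_of_close[OF assms(1) True] by blast
    have "(\<Sum>i\<in>{0..<int D}. \<Sum>j\<in>{0..<int D}. 1) \<le> ?S"
    proof (intro sum_mono)
      fix i j assume ij: "i \<in> {0..<int D}" "j \<in> {0..<int D}"
      let ?h = "e - j + i"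
      \<comment> \<open>The \<open>- 1\<close> cancels the \<open>+ 1\<close> in the bound on
        \<open>e\<close>.\<close>
      have "\<bar>i - j\<bar> \<le> int D - 1" using ij by auto
      then have "\<bar>real_of_int (i - j)\<bar> \<le> real D - 1" by linarith
      then have "\<bar>real_of_int ?h\<bar> \<le> of_int R"
        using e(2) assms(2) by simp
      then have "\<bar>?h\<bar> \<le> R" by linarith
      then have "?h \<in> {-R..R}" by auto
      moreover have "of_bool (K dvd \<lfloor>of_int K * z\<rfloor> - \<lfloor>of_int K * y\<rfloor> - (?h + j - i)) = (1::real)"
        using e(1) by simp
      ultimately show "(1::real) \<le> (\<Sum>h\<in>{-R..R}. of_bool (K dvd \<lfloor>of_int K * z\<rfloor> - \<lfloor>of_int K * y\<rfloor> - (h + j - i)))"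
        using member_le_sum[of ?h "{-R..R}" "\<lambda>h. of_bool (K dvd \<lfloor>of_int K * z\<rfloor> - \<lfloor>of_int K * y\<rfloor> - (h + j - i)) :: real"]
        by simp
    qed
    then show ?thesis using True by (simp add: power2_eq_square)
  qed (simp add: sum_nonneg)
  show ?thesis
    unfolding sum_window_corr close_pairs_def sum_distrib_left
    by (intro sum_mono pair)
qed

text \<open>Here \<open>R\<close> is small enough that every counted pair is close. By
  \<open>2 * R < K\<close> the shifts are distinct modulo \<open>K\<close>, so each
  \<open>(i, j)\<close> counts a pair at most once.\<close>

lemma window_corr_le_close_pairs:
  assumes "K > 0" and "of_int R + real D \<le> r * of_int K" and "2 * R < K"
  shows "(\<Sum>h\<in>{-R..R}. window_corr x N K D h) \<le> (real D)\<^sup>2 * close_pairs x N r"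
proof -
  have pair: "(\<Sum>i\<in>{0..<int D}. \<Sum>j\<in>{0..<int D}. \<Sum>h\<in>{-R..R}.
        of_bool (K dvd \<lfloor>of_int K * z\<rfloor> - \<lfloor>of_int K * y\<rfloor> - (h + j - i)))
     \<le> (real D)\<^sup>2 * of_bool (dist_nearest_int (y - z) \<le> r)" (is "?S \<le> _") for y z
  proof (cases "dist_nearest_int (y - z) \<le> r")
    case True
    have "?S \<le> (\<Sum>i\<in>{0..<int D}. \<Sum>j\<in>{0..<int D}. 1)"
    proof (intro sum_mono sum_of_bool_le_one)
      fix i j h h'
      assume "h \<in> {-R..R}" "h' \<in> {-R..R}"
        "K dvd \<lfloor>of_int K * z\<rfloor> - \<lfloor>of_int K * y\<rfloor> - (h + j - i)"
        "K dvd \<lfloor>of_int K * z\<rfloor> - \<lfloor>of_int K * y\<rfloor> - (h' + j - i)"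
      then have "h + j - i = h' + j - i"
        using assms(3) by (intro eq_of_dvd_diff_small) auto
      then show "h = h'" by simp
    qed
    then show ?thesis using True by (simp add: power2_eq_square)
  next
    case False
    have "of_bool (K dvd \<lfloor>of_int K * z\<rfloor> - \<lfloor>of_int K * y\<rfloor> - (h + j - i)) = (0::real)"
      if "i \<in> {0..<int D}" "j \<in> {0..<int D}" "h \<in> {-R..R}" for i j h
    proof -
      have "\<bar>h + j - i\<bar> + 1 \<le> R + int D"
        using that by auto
      then have "\<bar>real_of_int (h + j - i)\<bar> + 1 \<le> of_int R + real D"
        by linarith
      then have "(\<bar>real_of_int (h + j - i)\<bar> + 1) / of_int K \<le> r"
        using assms(1,2) by (simp add: divide_le_eq)
      then show ?thesis
        using dist_nearest_int_grid[OF assms(1), of z y "h + j - i"] False by auto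
    qed
    then have "?S = 0" by (intro sum.neutral ballI) 
    then show ?thesis using False by simp
  qed
  show ?thesis
    unfolding sum_window_corr close_pairs_def sum_distrib_left
    by (intro sum_mono pair)
qed

section \<open>Close pairs when the window counts have small variance\<close>

text \<open>The relative excess \<open>\<theta>\<close> of the second moment over its minimum
  bounds, by \<open>window_corr_deviation\<close>, the relative error of the correlation at every
  shift. Summing over the \<open>2 * R + 1\<close> shifts and cancelling \<open>D * D\<close> gives
  the estimate.\<close>

lemma close_pairs_upper:
  assumes "K > 0" and "D > 0" and "R \<ge> 0" and "r * of_int K + real D \<le> of_int R"
    and "window_corr x N K D 0 \<le> (1 + \<theta>) * ((real N * real D)\<^sup>2 / of_int K)"
  shows "close_pairs x N r \<le> (2 * of_int R + 1) * ((1 + \<theta>) * ((real N)\<^sup>2 / of_int K))"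
proof -
  have "(real D)\<^sup>2 * close_pairs x N r \<le> (\<Sum>h\<in>{-R..R}. window_corr x N K D h)"
    by (rule close_pairs_le_window_corr) (use assms in auto)
  also have "\<dots> \<le> (\<Sum>h\<in>{-R..R}. (1 + \<theta>) * ((real N * real D)\<^sup>2 / of_int K))"
  proof (rule sum_mono)
    fix h
    show "window_corr x N K D h \<le> (1 + \<theta>) * ((real N * real D)\<^sup>2 / of_int K)"
      using window_corr_deviation[OF assms(1), of x N D h] assms(5)
      unfolding distrib_right by linarith
  qed
  also have "\<dots> = (real D)\<^sup>2 * ((2 * of_int R + 1) * ((1 + \<theta>) * ((real N)\<^sup>2 / of_int K)))"
    using assms(3) by (simp add: power_mult_distrib)
  finally show ?thesis
    by (rule mult_left_le_imp_le) (use assms(2) in simp)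
qed

lemma close_pairs_lower:
  assumes "K > 0" and "D > 0" and "R \<ge> 0" and "of_int R + real D \<le> r * of_int K" and "2 * R < K"
    and "window_corr x N K D 0 \<le> (1 + \<theta>) * ((real N * real D)\<^sup>2 / of_int K)"
  shows "(2 * of_int R + 1) * ((1 - \<theta>) * ((real N)\<^sup>2 / of_int K)) \<le> close_pairs x N r"
proof -
  have "(real D)\<^sup>2 * ((2 * of_int R + 1) * ((1 - \<theta>) * ((real N)\<^sup>2 / of_int K)))
      = (\<Sum>h\<in>{-R..R}. (1 - \<theta>) * ((real N * real D)\<^sup>2 / of_int K))"
    using assms(3) by (simp add: power_mult_distrib)
  also have "\<dots> \<le> (\<Sum>h\<in>{-R..R}. window_corr x N K D h)"
  proof (rule sum_mono)
    fix h
    show "(1 - \<theta>) * ((real N * real D)\<^sup>2 / of_int K) \<le> window_corr x N K D h"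
      using window_corr_deviation[OF assms(1), of x N D h] assms(6)
      unfolding left_diff_distrib distrib_right by linarith
  qed
  also have "\<dots> \<le> (real D)\<^sup>2 * close_pairs x N r"
    by (rule window_corr_le_close_pairs) (use assms in auto)
  finally show ?thesis
    by (rule mult_left_le_imp_le) (use assms(2) in simp)
qed

section \<open>Limits in \<open>N\<close>: from scale \<open>\<beta>\<close> to scale
  \<open>\<alpha>\<close>\<close>

lemma close_pairs_mono: "r \<le> r' \<Longrightarrow> close_pairs x N r \<le> close_pairs x N r'"
  unfolding close_pairs_def by (intro sum_mono) auto

text \<open>The subtracted \<open>N\<close> is the diagonal, all of which is close because
  \<open>s \<ge> 0\<close>.\<close>

lemma pair_corr_eq_close_pairs:
  assumes "N \<ge> 1" and "s \<ge> 0"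
  shows "pair_corr x \<gamma> s N
           = (close_pairs x N (s / real N powr \<gamma>) - real N) * (real N powr \<gamma> / (real N)\<^sup>2)"
proof -
  define r where "r = s / real N powr \<gamma>"
  have "r \<ge> 0" using assms by (simp add: r_def)
  let ?I = "{1..N} \<times> {1..N}"
  let ?C = "{(m, n). m \<in> {1..N} \<and> n \<in> {1..N} \<and> m \<noteq> n \<and> dist_nearest_int (x m - x n) \<le> r}"
  let ?A = "?I \<inter> {(m, n). dist_nearest_int (x m - x n) \<le> r}"
  let ?\<Delta> = "(\<lambda>n. (n, n)) ` {1..N}"
  have "close_pairs x N r = (\<Sum>p\<in>?I. of_bool (case p of (m, n) \<Rightarrow> dist_nearest_int (x m - x n) \<le> r))"
    unfolding close_pairs_def sum.cartesian_product by (intro sum.cong) auto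
  also have "\<dots> = real (card ?A)"
    by (simp add: sum_of_bool_eq)
  also have "?A = ?C \<union> ?\<Delta>"
    using \<open>r \<ge> 0\<close> by (auto simp: dist_nearest_int_def)
  also have "card (?C \<union> ?\<Delta>) = card ?C + card ?\<Delta>"
    by (rule card_Un_disjoint) (auto intro: finite_subset[of _ ?I])
  also have "card ?\<Delta> = N"
    by (subst card_image) (auto simp: inj_on_def)
  finally have "real (card ?C) = close_pairs x N r - real N" by simp
  moreover have "1 / real N powr (2 - \<gamma>) = real N powr \<gamma> / (real N)\<^sup>2"
    using assms(1) by (simp add: powr_diff)
  ultimately show ?thesis
    unfolding pair_corr_def r_def by (simp add: mult.commute)
qed

lemma tendsto_ceiling_powr_ratio:
  fixes \<beta> :: real
  assumes "\<beta> > 0"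
  shows "(\<lambda>N. of_int \<lceil>real N powr \<beta>\<rceil> / real N powr \<beta>) \<longlonglongrightarrow> 1"
proof (rule tendsto_sandwich)
  show "\<forall>\<^sub>F N in sequentially. 1 \<le> of_int \<lceil>real N powr \<beta>\<rceil> / real N powr \<beta>"
    using eventually_gt_at_top[of 0] by eventually_elim (simp add: le_divide_eq)
  show "\<forall>\<^sub>F N in sequentially. of_int \<lceil>real N powr \<beta>\<rceil> / real N powr \<beta> \<le> 1 + real N powr (-\<beta>)"
    using eventually_gt_at_top[of 0]
  proof eventually_elim
    case (elim N)
    have "of_int \<lceil>real N powr \<beta>\<rceil> \<le> real N powr \<beta> + 1" by linarith
    then show ?case
      using elim by (simp add: divide_le_eq powr_minus distrib_right)
  qed
  have "(\<lambda>N. real N powr (-\<beta>)) \<longlonglongrightarrow> 0"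
    using assms by (intro tendsto_neg_powr filterlim_real_sequentially) auto
  then show "(\<lambda>N. 1 + real N powr (-\<beta>)) \<longlonglongrightarrow> 1"
    using tendsto_add[OF tendsto_const, of _ 0 sequentially 1] by simp
qed simp

text \<open>The limits \<open>2 * (d + 1)\<close> of the \<open>D\<close> pair correlations sum to
  \<open>D * (D + 1)\<close>, which contributes \<open>1 + 1 / D\<close> after division by
  \<open>D * D\<close>. The diagonal contributes at most another \<open>1 / D\<close>. Taking 3
  instead of 2 leaves room for a statement about large \<open>N\<close>.\<close>

lemma eventually_window_corr_0_le:
  assumes "0 < \<beta>" and "\<beta> \<le> 1" and "has_PPC \<beta> x" and "D > 0"
  shows "\<forall>\<^sub>F N in sequentially. window_corr x N \<lceil>real N powr \<beta>\<rceil> D 0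
           \<le> (1 + 3 / real D) * ((real N * real D)\<^sup>2 / of_int \<lceil>real N powr \<beta>\<rceil>)"
proof -
  define u where "u N = of_int \<lceil>real N powr \<beta>\<rceil> / real N powr \<beta>" for N
  define b where "b N = u N * (1 / real D + (\<Sum>d<D. pair_corr x \<beta> (real d + 1) N) / (real D)\<^sup>2)" for N
  have "u \<longlonglongrightarrow> 1"
    unfolding u_def by (rule tendsto_ceiling_powr_ratio) fact
  moreover have "(\<lambda>N. \<Sum>d<D. pair_corr x \<beta> (real d + 1) N) \<longlonglongrightarrow> (\<Sum>d<D. 2 * (real d + 1))"
    using assms(1,3) unfolding has_PPC_def by (intro tendsto_sum) (simp del: distrib_left_numeral)
  ultimately have "b \<longlonglongrightarrow> 1 * (1 / real D + (\<Sum>d<D. 2 * (real d + 1)) / (real D)\<^sup>2)"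
    unfolding b_def by (intro tendsto_mult tendsto_add tendsto_divide tendsto_const) (use assms in auto)
  moreover have "(\<Sum>d<D. 2 * (real d + 1)) = real D * (real D + 1)"
    by (induction D) (auto simp: algebra_simps)
  moreover have "1 * (1 / real D + real D * (real D + 1) / (real D)\<^sup>2) = 1 + 2 / real D"
    using assms(4) by (simp add: power2_eq_square field_simps)
  ultimately have "b \<longlonglongrightarrow> 1 + 2 / real D"
    by (simp only:)
  moreover have "1 + 2 / real D < 1 + 3 / real D"
    using assms(4) by (simp add: divide_strict_right_mono)
  ultimately have "\<forall>\<^sub>F N in sequentially. b N < 1 + 3 / real D"
    by (rule order_tendstoD(2))
  \<comment> \<open>This provides the condition \<open>2 * int D \<le> K\<close> of
    \<open>window_corr_0_le\<close>.\<close>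
  moreover have "(\<lambda>N. 2 * real D * real N powr (-\<beta>)) \<longlonglongrightarrow> 2 * real D * 0"
    using assms(1) by (intro tendsto_mult tendsto_const tendsto_neg_powr filterlim_real_sequentially) auto
  then have "\<forall>\<^sub>F N in sequentially. 2 * real D * real N powr (-\<beta>) < 1"
    by (intro order_tendstoD(2)) auto
  then have "\<forall>\<^sub>F N in sequentially. 2 * real D \<le> real N powr \<beta>"
    using eventually_gt_at_top[of 0]
    by eventually_elim (simp add: powr_minus_divide divide_less_eq)
  ultimately show ?thesis
    using eventually_gt_at_top[of 0]
  proof eventually_elim
    case (elim N)
    define K where "K = \<lceil>real N powr \<beta>\<rceil>"
    have K: "real N powr \<beta> \<le> of_int K" "K > 0"
      using elim unfolding K_def by auto
    have D: "2 * int D \<le> K"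
      using elim(2) K(1) by linarith
    have "window_corr x N K D 0 \<le> (\<Sum>d<D. close_pairs x N ((real d + 1) / of_int K))"
      by (rule window_corr_0_le[OF K(2) D])
    \<comment> \<open>Rounding up in \<open>K\<close> makes the radii at most those of
      \<open>pair_corr\<close> with \<open>s = d + 1\<close>.\<close>
    also have "\<dots> \<le> (\<Sum>d<D. close_pairs x N ((real d + 1) / real N powr \<beta>))"
      using K elim(3) by (intro sum_mono close_pairs_mono divide_left_mono) auto
    also have "\<dots> = (\<Sum>d<D. real N + pair_corr x \<beta> (real d + 1) N * ((real N)\<^sup>2 / real N powr \<beta>))"
      using elim(3) by (intro sum.cong) (auto simp: pair_corr_eq_close_pairs)
    also have "\<dots> = real D * real N + (\<Sum>d<D. pair_corr x \<beta> (real d + 1) N) * ((real N)\<^sup>2 / real N powr \<beta>)"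
      by (simp only: sum.distrib sum_distrib_right) simp
    \<comment> \<open>The diagonal is negligible for large \<open>D\<close> because
      \<open>\<beta> \<le> 1\<close>.\<close>
    also have "real D * real N \<le> real D * ((real N)\<^sup>2 / real N powr \<beta>)"
    proof -
      have "real N powr \<beta> \<le> real N powr 1"
        using elim(3) assms(2) by (intro powr_mono) auto
      then have "real N * real N powr \<beta> \<le> (real N)\<^sup>2"
        unfolding power2_eq_square by (intro mult_left_mono) simp_all
      then show ?thesis
        using elim(3) by (intro mult_left_mono) (simp_all add: le_divide_eq)
    qed
    also have "real D * ((real N)\<^sup>2 / real N powr \<beta>)
          + (\<Sum>d<D. pair_corr x \<beta> (real d + 1) N) * ((real N)\<^sup>2 / real N powr \<beta>)
        = b N * ((real N * real D)\<^sup>2 / of_int K)"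
      using K(2) elim(3) assms(4) unfolding b_def u_def K_def[symmetric]
      by (simp add: field_simps power2_eq_square)
    also have "\<dots> \<le> (1 + 3 / real D) * ((real N * real D)\<^sup>2 / of_int K)"
      using elim(1) K(2) by (intro mult_right_mono) auto
    finally show ?case unfolding K_def by simp
  qed
qed

text \<open>For fixed \<open>D\<close> the boundary effects vanish as \<open>N\<close> grows,
  leaving a relative error of \<open>3 / D\<close>. The assumption \<open>half\<close> keeps the
  shifts in the lower bound from wrapping around the circle.\<close>

lemma pair_corr_tendsto:
  assumes "\<alpha> < \<beta>" and "0 < \<beta>" and "\<beta> \<le> 1" and "has_PPC \<beta> x" and "s > 0"
    and half: "\<forall>\<^sub>F N in sequentially. s / real N powr \<alpha> \<le> 1 / 2"
  shows "pair_corr x \<alpha> s \<longlonglongrightarrow> 2 * s"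
proof -
  \<comment> \<open>An upper bound for the cell width \<open>1 / K\<close> measured in units of the
    coarse scale \<open>1 / N powr \<alpha>\<close>.\<close>
  define \<epsilon> where "\<epsilon> N = real N powr (\<alpha> - \<beta>)" for N
  have \<epsilon>: "\<epsilon> \<longlonglongrightarrow> 0"
    unfolding \<epsilon>_def using assms(1) by (intro tendsto_neg_powr filterlim_real_sequentially) auto
  \<comment> \<open>This is the normalised diagonal \<open>N * (N powr \<alpha> / N^2)\<close>; the
    upper bound simply drops it.\<close>
  have \<epsilon>1: "(\<lambda>N. real N powr (\<alpha> - 1)) \<longlonglongrightarrow> 0"
    using assms(1,3) by (intro tendsto_neg_powr filterlim_real_sequentially) auto
  have upper: "\<forall>\<^sub>F N in sequentially.
      pair_corr x \<alpha> s N \<le> (2 * s + (2 * real D + 3) * \<epsilon> N) * (1 + 3 / real D)" if "D > 0" for D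
    using eventually_window_corr_0_le[OF assms(2-4) that] eventually_gt_at_top[of 0]
  proof eventually_elim
    case (elim N)
    define K where "K = \<lceil>real N powr \<beta>\<rceil>"
    define r where "r = s / real N powr \<alpha>"
    \<comment> \<open>Rounding up adds at most 1 to \<open>R\<close>, hence 2 to
      \<open>2 * R + 1\<close>; this explains the constant \<open>2 * D + 3\<close>.\<close>
    define R where "R = \<lceil>r * of_int K\<rceil> + int D"
    have K: "real N powr \<beta> \<le> of_int K" "K > 0"
      using elim unfolding K_def by auto
    have "r > 0" using assms(5) elim by (simp add: r_def)
    then have "r * of_int K > 0" using K(2) by simp
    then have R: "R \<ge> 0" "r * of_int K + real D \<le> of_int R"
      "2 * of_int R + 1 \<le> 2 * (r * of_int K) + (2 * real D + 3)"
      using ceiling_correct[of "r * of_int K"] unfolding R_def by simp_all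
    have "close_pairs x N r \<le> (2 * of_int R + 1) * ((1 + 3 / real D) * ((real N)\<^sup>2 / of_int K))"
      by (rule close_pairs_upper) (use K R that elim(1) in \<open>auto simp: K_def\<close>)
    also have "\<dots> \<le> (2 * (r * of_int K) + (2 * real D + 3)) * ((1 + 3 / real D) * ((real N)\<^sup>2 / of_int K))"
      using R(3) K(2) by (intro mult_right_mono) auto
    finally have "pair_corr x \<alpha> s N \<le> (2 * (r * of_int K) + (2 * real D + 3))
        * ((1 + 3 / real D) * ((real N)\<^sup>2 / of_int K)) * (real N powr \<alpha> / (real N)\<^sup>2)"
      using elim(2) assms(5) unfolding r_def
      by (subst pair_corr_eq_close_pairs) (simp, simp, intro mult_right_mono, linarith, simp)
    also have "\<dots> = (2 * s + (2 * real D + 3) * (real N powr \<alpha> / of_int K)) * (1 + 3 / real D)"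
      using K(2) elim(2) that unfolding r_def by (simp add: field_simps)
    also have "real N powr \<alpha> / of_int K \<le> \<epsilon> N"
      unfolding \<epsilon>_def powr_diff using K elim(2) by (intro divide_left_mono) auto
    finally show ?case
      by (simp add: mult_left_mono mult_right_mono)
  qed
  \<comment> \<open>\<open>D \<ge> 3\<close> makes the factor \<open>1 - 3 / D\<close> nonnegative,
    so inequalities can be multiplied by it.\<close>
  have lower: "\<forall>\<^sub>F N in sequentially.
      (2 * s - (2 * real D + 1) * \<epsilon> N) * (1 - 3 / real D) - real N powr (\<alpha> - 1) \<le> pair_corr x \<alpha> s N"
    if "D \<ge> 3" for D
  proof -
    have "D > 0" using that by simp
    \<comment> \<open>Eventually \<open>D \<le> r * K\<close>, so that \<open>R\<close> below is
      nonnegative.\<close>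
    have "(\<lambda>N. real D * \<epsilon> N) \<longlonglongrightarrow> 0"
      using tendsto_mult[OF tendsto_const \<epsilon>, of "real D"] by simp
    then have "\<forall>\<^sub>F N in sequentially. real D * \<epsilon> N < s"
      using assms(5) by (rule order_tendstoD(2))
    then show ?thesis
      using eventually_window_corr_0_le[OF assms(2-4) \<open>D > 0\<close>] eventually_gt_at_top[of 0] half
    proof eventually_elim
      case (elim N)
      define K where "K = \<lceil>real N powr \<beta>\<rceil>"
      define r where "r = s / real N powr \<alpha>"
      define R where "R = \<lfloor>r * of_int K\<rfloor> - int D"
      have K: "real N powr \<beta> \<le> of_int K" "K > 0"
        using elim unfolding K_def by auto
      have \<epsilon>_ge: "real N powr \<alpha> / of_int K \<le> \<epsilon> N"
        unfolding \<epsilon>_def powr_diff using K elim(3) by (intro divide_left_mono) auto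
      then have "real D * (real N powr \<alpha> / of_int K) \<le> real D * \<epsilon> N"
        by (intro mult_left_mono) auto
      then have "real D * (real N powr \<alpha> / of_int K) \<le> s"
        using elim(1) by linarith
      then have "real D \<le> r * of_int K"
        using K(2) elim(3) unfolding r_def by (simp add: field_simps)
      then have R: "R \<ge> 0" "of_int R + real D \<le> r * of_int K"
        "2 * (r * of_int K) - (2 * real D + 1) \<le> 2 * of_int R + 1"
        using floor_correct[of "r * of_int K"] by (auto simp: R_def le_floor_iff algebra_simps)
      have "r * of_int K \<le> 1 / 2 * of_int K"
        using elim(4) K(2) unfolding r_def by (intro mult_right_mono) auto
      \<comment> \<open>Strict because \<open>R\<close> stays at least \<open>D > 0\<close> below
        \<open>r * K \<le> K / 2\<close>.\<close>
      then have R2: "2 * R < K"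
        using R(2) that by linarith
      have D3: "0 \<le> 1 - 3 / real D"
        using that by simp
      have "(2 * s - (2 * real D + 1) * \<epsilon> N) * (1 - 3 / real D)
          \<le> (2 * s - (2 * real D + 1) * (real N powr \<alpha> / of_int K)) * (1 - 3 / real D)"
        using \<epsilon>_ge D3 by (intro mult_right_mono diff_left_mono mult_left_mono) auto
      also have "\<dots> = (2 * (r * of_int K) - (2 * real D + 1))
          * ((1 - 3 / real D) * ((real N)\<^sup>2 / of_int K)) * (real N powr \<alpha> / (real N)\<^sup>2)"
        using K(2) elim(3) that unfolding r_def by (simp add: field_simps)
      also have "\<dots> \<le> (2 * of_int R + 1)
          * ((1 - 3 / real D) * ((real N)\<^sup>2 / of_int K)) * (real N powr \<alpha> / (real N)\<^sup>2)"
        using R(3) K(2) D3 by (intro mult_right_mono mult_nonneg_nonneg) auto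
      also have "\<dots> \<le> close_pairs x N r * (real N powr \<alpha> / (real N)\<^sup>2)"
        by (intro mult_right_mono close_pairs_lower) (use K R R2 that elim(2) in \<open>auto simp: K_def\<close>)
      also have "\<dots> = pair_corr x \<alpha> s N + real N powr (\<alpha> - 1)"
        using elim(3) assms(5) unfolding r_def
        by (subst pair_corr_eq_close_pairs) (auto simp: powr_diff field_simps power2_eq_square)
      finally show ?case by simp
    qed
  qed
  have invD: "(\<lambda>D. 3 / real D) \<longlonglongrightarrow> 0"
    by (rule lim_const_over_n)
  show ?thesis
  proof (rule order_tendstoI)
    fix l assume "l < 2 * s"
    have "(\<lambda>D. 2 * s * (1 - 3 / real D)) \<longlonglongrightarrow> 2 * s * (1 - 0)"
      by (intro tendsto_intros invD)
    \<comment> \<open>\<open>D\<close> is fixed first, with the limit in \<open>N\<close> of the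
      lower bound still above \<open>l\<close>; only then does \<open>N\<close> grow.\<close>
    then have "\<forall>\<^sub>F D in sequentially. l < 2 * s * (1 - 3 / real D)"
      using \<open>l < 2 * s\<close> by (intro order_tendstoD(1)) auto
    then obtain D where D: "l < 2 * s * (1 - 3 / real D)" "D \<ge> 3"
      using eventually_happens'[OF sequentially_bot eventually_conj[OF _ eventually_ge_at_top[of 3]]]
      by blast
    have "(\<lambda>N. (2 * s - (2 * real D + 1) * \<epsilon> N) * (1 - 3 / real D) - real N powr (\<alpha> - 1))
        \<longlonglongrightarrow> (2 * s - (2 * real D + 1) * 0) * (1 - 3 / real D) - 0"
      by (intro tendsto_diff tendsto_mult tendsto_const \<epsilon> \<epsilon>1)
    then have "\<forall>\<^sub>F N in sequentially.
        l < (2 * s - (2 * real D + 1) * \<epsilon> N) * (1 - 3 / real D) - real N powr (\<alpha> - 1)"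
      using D(1) by (intro order_tendstoD(1)) auto
    then show "\<forall>\<^sub>F N in sequentially. l < pair_corr x \<alpha> s N"
      using lower[OF D(2)] by eventually_elim linarith
  next
    fix l assume "2 * s < l"
    have "(\<lambda>D. 2 * s * (1 + 3 / real D)) \<longlonglongrightarrow> 2 * s * (1 + 0)"
      by (intro tendsto_intros invD)
    then have "\<forall>\<^sub>F D in sequentially. 2 * s * (1 + 3 / real D) < l"
      using \<open>2 * s < l\<close> by (intro order_tendstoD(2)) auto
    then obtain D where D: "2 * s * (1 + 3 / real D) < l" "D > 0"
      using eventually_happens'[OF sequentially_bot eventually_conj[OF _ eventually_gt_at_top[of 0]]]
      by blast
    have "(\<lambda>N. (2 * s + (2 * real D + 3) * \<epsilon> N) * (1 + 3 / real D))
        \<longlonglongrightarrow> (2 * s + (2 * real D + 3) * 0) * (1 + 3 / real D)"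
      by (intro tendsto_add tendsto_mult tendsto_const \<epsilon>)
    then have "\<forall>\<^sub>F N in sequentially. (2 * s + (2 * real D + 3) * \<epsilon> N) * (1 + 3 / real D) < l"
      using D(1) by (intro order_tendstoD(2)) auto
    then show "\<forall>\<^sub>F N in sequentially. pair_corr x \<alpha> s N < l"
      using upper[OF D(2)] by eventually_elim linarith
  qed
qed

theorem theorem4:
  fixes \<alpha> \<beta> :: real and x :: "nat \<Rightarrow> real"
  assumes "0 \<le> \<alpha>" and "\<alpha> < \<beta>" and "\<beta> \<le> 1"
    and "\<forall>n\<ge>1. x n \<in> {0..1}"
    and "has_PPC \<beta> x"
  shows "has_PPC \<alpha> x"
proof (cases "\<alpha> = 0")
  case True
  have "pair_corr x 0 s \<longlonglongrightarrow> 2 * s" if "0 < s" "s \<le> 1 / 2" for s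
  proof (rule pair_corr_tendsto)
    \<comment> \<open>At exponent 0 the radius is constantly \<open>s\<close>, and the restriction
      on \<open>s\<close> in \<open>0\<close>-PPC is exactly what is required.\<close>
    show "\<forall>\<^sub>F N in sequentially. s / real N powr 0 \<le> 1 / 2"
      using eventually_gt_at_top[of 0] by eventually_elim (use that in simp)
  qed (use assms True that in auto)
  then show ?thesis
    using True by (simp add: has_PPC_def)
next
  case False
  have "pair_corr x \<alpha> s \<longlonglongrightarrow> 2 * s" if "0 < s" for s
  proof (rule pair_corr_tendsto)
    \<comment> \<open>For \<open>\<alpha> > 0\<close> the radius tends to 0, so every
      \<open>s\<close> is eventually admissible.\<close>
    have "(\<lambda>N. s * real N powr (-\<alpha>)) \<longlonglongrightarrow> s * 0"
      using assms(1) False by (intro tendsto_intros tendsto_neg_powr filterlim_real_sequentially) auto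
    then have "\<forall>\<^sub>F N in sequentially. s * real N powr (-\<alpha>) < 1 / 2"
      by (intro order_tendstoD(2)) auto
    then show "\<forall>\<^sub>F N in sequentially. s / real N powr \<alpha> \<le> 1 / 2"
      by eventually_elim (simp add: powr_minus_divide)
  qed (use assms that in auto)
  then show ?thesis
    using False by (simp add: has_PPC_def)
qed

end
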